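(* Let $C_1,C_2,C_3,C_4$ be constants with $C_1^2+C_2^2\neq0$ and let $a_2$ be a real constant. The (locally defined) rotationally symmetric map $\varphi:(S^2,dr^2+\sin^2r\,d\theta^2)\to(S^2,d\rho^2+\sin^2\rho\,d\phi^2)$ with $\varphi(r,\theta)=(\rho(r),a_2)$ is proper biharmonic if $$\rho(r)=\int\left\{\frac{\int\left(C_1\sin r\int\frac{dr}{\sin r}+C_2\sin r\right)dr+C_3}{\sin r}\right\}dr+C_4.$$
   Context: All objects are smooth. $(r,\theta)$ and $(\rho,\phi)$ are geodesic polar coordinates on the domain and target unit 2-spheres, with $r,\rho\in(0,\pi)$. The map is given by its expression in these coordinates and is locally defined: it is considered on an open interval of $r\in(0,\pi)$ on which $\rho(r)\in(0,\pi)$. Each integral sign denotes a fixed choice of antiderivative. The tension field of a map $\varphi:(M,g)\to(N,h)$ is $\tau(\varphi)=\mathrm{Tr}_g\nabla d\varphi$; $\varphi$ is harmonic if $\tau(\varphi)=0$, and biharmonic if $\tau_2(\varphi)=\mathrm{Tr}_g(\nabla^\varphi\nabla^\varphi-\nabla^\varphi_{\nabla^M})\tau(\varphi)-\mathrm{Tr}_gR^N(d\varphi,\tau(\varphi))d\varphi=0$, where $R^N(X,Y)Z=[\nabla^N_X,\nabla^N_Y]Z-\nabla^N_{[X,Y]}Z$. A proper biharmonic map is a biharmonic map that is not harmonic. *)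

theory Defs
  imports "HOL-Analysis.Analysis"
begin

text \<open>
  All geometry is done in a single chart: an open subset of the source manifold is an open set
  of \<open>real ^ 'm\<close>, an open subset of the target an open set of \<open>real ^ 'n\<close>, a metric is its matrix
  of components, and vector fields (also vector fields along a map) are given by their component
  vectors in the coordinate frame.
\<close>

primrec continuously_differentiable_on ::
    "nat \<Rightarrow> (real ^ 'm) set \<Rightarrow> (real ^ 'm \<Rightarrow> real ^ 'n) \<Rightarrow> bool" where
  "continuously_differentiable_on 0 U f \<longleftrightarrow> continuous_on U f"
| "continuously_differentiable_on (Suc k) U f \<longleftrightarrow>
     (\<forall>x\<in>U. f differentiable (at x)) \<and>
     (\<forall>v. continuously_differentiable_on k U (\<lambda>x. frechet_derivative f (at x) v))"

definition smooth_on :: "(real ^ 'm) set \<Rightarrow> (real ^ 'm \<Rightarrow> real ^ 'n) \<Rightarrow> bool" where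
  "smooth_on U f \<longleftrightarrow> (\<forall>k. continuously_differentiable_on k U f)"

type_synonym 'n metric = "real ^ 'n \<Rightarrow> real ^ 'n ^ 'n"
type_synonym 'n vector_field = "real ^ 'n \<Rightarrow> real ^ 'n"

abbreviation coord_field :: "'n \<Rightarrow> ('n :: finite) vector_field" where
  "coord_field i \<equiv> (\<lambda>_. axis i 1)"

definition metric_deriv :: "('n :: finite) metric \<Rightarrow> real ^ 'n \<Rightarrow> 'n \<Rightarrow> 'n \<Rightarrow> 'n \<Rightarrow> real" where
  "metric_deriv g x k i j = frechet_derivative (\<lambda>y. g y $ i $ j) (at x) (axis k 1)"

text \<open>\<open>christoffel g x k i j\<close> is the symbol with upper index \<open>k\<close> and lower indices \<open>i\<close>, \<open>j\<close>.\<close>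

definition christoffel :: "('n :: finite) metric \<Rightarrow> real ^ 'n \<Rightarrow> 'n \<Rightarrow> 'n \<Rightarrow> 'n \<Rightarrow> real" where
  "christoffel g x k i j =
     (\<Sum>l\<in>UNIV. matrix_inv (g x) $ k $ l *
        (metric_deriv g x i j l + metric_deriv g x j i l - metric_deriv g x l i j)) / 2"

definition trace_wrt :: "('m :: finite) metric \<Rightarrow>
    ('m vector_field \<Rightarrow> 'm vector_field \<Rightarrow> real ^ 'm \<Rightarrow> real ^ 'n) \<Rightarrow> real ^ 'm \<Rightarrow> real ^ 'n" where
  "trace_wrt g B x =
     (\<Sum>i\<in>UNIV. \<Sum>j\<in>UNIV. (matrix_inv (g x) $ i $ j) *\<^sub>R B (coord_field i) (coord_field j) x)"

definition pushforward :: "(real ^ 'm \<Rightarrow> real ^ 'n) \<Rightarrow> ('m :: finite) vector_field \<Rightarrow>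
    real ^ 'm \<Rightarrow> real ^ 'n" where
  "pushforward \<phi> X x = frechet_derivative \<phi> (at x) (X x)"

text \<open>The connection induced on the pull-back bundle by the Levi-Civita connection of \<open>h\<close>; here \<open>V\<close>
  is a vector field along \<open>\<phi>\<close>.\<close>

definition pullback_conn :: "('n :: finite) metric \<Rightarrow> (real ^ 'm \<Rightarrow> real ^ 'n) \<Rightarrow>
    ('m :: finite) vector_field \<Rightarrow> (real ^ 'm \<Rightarrow> real ^ 'n) \<Rightarrow> real ^ 'm \<Rightarrow> real ^ 'n" where
  "pullback_conn h \<phi> X V x =
     frechet_derivative V (at x) (X x) +
     (\<chi> a. \<Sum>b\<in>UNIV. \<Sum>c\<in>UNIV.
        christoffel h (\<phi> x) a b c * pushforward \<phi> X x $ b * V x $ c)"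

definition levi_civita :: "('n :: finite) metric \<Rightarrow>
    'n vector_field \<Rightarrow> 'n vector_field \<Rightarrow> 'n vector_field" where
  "levi_civita g X Y = pullback_conn g (\<lambda>y. y) X Y"

definition lie_bracket :: "('n :: finite) vector_field \<Rightarrow> 'n vector_field \<Rightarrow> 'n vector_field" where
  "lie_bracket X Y x = frechet_derivative Y (at x) (X x) - frechet_derivative X (at x) (Y x)"

definition curvature :: "('n :: finite) metric \<Rightarrow>
    'n vector_field \<Rightarrow> 'n vector_field \<Rightarrow> 'n vector_field \<Rightarrow> 'n vector_field" where
  "curvature h X Y Z x =
     levi_civita h X (levi_civita h Y Z) x - levi_civita h Y (levi_civita h X Z) x
     - levi_civita h (lie_bracket X Y) Z x"

text \<open>The curvature is tensorial, so its value on tangent vectors at \<open>y\<close> may be computed from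
  arbitrary extensions to vector fields; the ones with constant components are used.\<close>

definition curvature_at :: "('n :: finite) metric \<Rightarrow> real ^ 'n \<Rightarrow>
    real ^ 'n \<Rightarrow> real ^ 'n \<Rightarrow> real ^ 'n \<Rightarrow> real ^ 'n" where
  "curvature_at h y u v w = curvature h (\<lambda>_. u) (\<lambda>_. v) (\<lambda>_. w) y"

definition second_fundamental_form :: "('m :: finite) metric \<Rightarrow> ('n :: finite) metric \<Rightarrow>
    (real ^ 'm \<Rightarrow> real ^ 'n) \<Rightarrow> 'm vector_field \<Rightarrow> 'm vector_field \<Rightarrow> real ^ 'm \<Rightarrow> real ^ 'n" where
  "second_fundamental_form g h \<phi> X Y x =
     pullback_conn h \<phi> X (pushforward \<phi> Y) x - pushforward \<phi> (levi_civita g X Y) x"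

definition tension_field :: "('m :: finite) metric \<Rightarrow> ('n :: finite) metric \<Rightarrow>
    (real ^ 'm \<Rightarrow> real ^ 'n) \<Rightarrow> real ^ 'm \<Rightarrow> real ^ 'n" where
  "tension_field g h \<phi> = trace_wrt g (second_fundamental_form g h \<phi>)"

definition rough_laplacian :: "('m :: finite) metric \<Rightarrow> ('n :: finite) metric \<Rightarrow>
    (real ^ 'm \<Rightarrow> real ^ 'n) \<Rightarrow> (real ^ 'm \<Rightarrow> real ^ 'n) \<Rightarrow> real ^ 'm \<Rightarrow> real ^ 'n" where
  "rough_laplacian g h \<phi> V =
     trace_wrt g (\<lambda>X Y x. pullback_conn h \<phi> X (pullback_conn h \<phi> Y V) x
                         - pullback_conn h \<phi> (levi_civita g X Y) V x)"

definition bitension_field :: "('m :: finite) metric \<Rightarrow> ('n :: finite) metric \<Rightarrow>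
    (real ^ 'm \<Rightarrow> real ^ 'n) \<Rightarrow> real ^ 'm \<Rightarrow> real ^ 'n" where
  "bitension_field g h \<phi> x =
     rough_laplacian g h \<phi> (tension_field g h \<phi>) x
     - trace_wrt g (\<lambda>X Y x. curvature_at h (\<phi> x)
          (pushforward \<phi> X x) (tension_field g h \<phi> x) (pushforward \<phi> Y x)) x"

definition smooth_map :: "(real ^ 'm) set \<Rightarrow> (real ^ 'n) set \<Rightarrow> (real ^ 'm \<Rightarrow> real ^ 'n) \<Rightarrow> bool" where
  "smooth_map U V \<phi> \<longleftrightarrow> \<phi> ` U \<subseteq> V \<and> smooth_on U \<phi>"

definition harmonic_map :: "(real ^ 'm) set \<Rightarrow> ('m :: finite) metric \<Rightarrow>
    (real ^ 'n) set \<Rightarrow> ('n :: finite) metric \<Rightarrow> (real ^ 'm \<Rightarrow> real ^ 'n) \<Rightarrow> bool" where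
  "harmonic_map U g V h \<phi> \<longleftrightarrow> smooth_map U V \<phi> \<and> (\<forall>x\<in>U. tension_field g h \<phi> x = 0)"

definition biharmonic_map :: "(real ^ 'm) set \<Rightarrow> ('m :: finite) metric \<Rightarrow>
    (real ^ 'n) set \<Rightarrow> ('n :: finite) metric \<Rightarrow> (real ^ 'm \<Rightarrow> real ^ 'n) \<Rightarrow> bool" where
  "biharmonic_map U g V h \<phi> \<longleftrightarrow> smooth_map U V \<phi> \<and> (\<forall>x\<in>U. bitension_field g h \<phi> x = 0)"

definition proper_biharmonic_map :: "(real ^ 'm) set \<Rightarrow> ('m :: finite) metric \<Rightarrow>
    (real ^ 'n) set \<Rightarrow> ('n :: finite) metric \<Rightarrow> (real ^ 'm \<Rightarrow> real ^ 'n) \<Rightarrow> bool" where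
  "proper_biharmonic_map U g V h \<phi> \<longleftrightarrow> biharmonic_map U g V h \<phi> \<and> \<not> harmonic_map U g V h \<phi>"

text \<open>Geodesic polar coordinates on the unit 2-sphere: component \<open>1\<close> is the distance from the pole
  and component \<open>2\<close> the angle. The angle ranges over all reals (the universal cover of the sphere
  without its two poles), so no branch of the angle has to be chosen.\<close>

definition polar_domain :: "real set \<Rightarrow> (real ^ 2) set" where
  "polar_domain I = {x. x $ 1 \<in> I}"

definition sphere_polar_metric :: "2 metric" where
  "sphere_polar_metric x = vector [vector [1, 0], vector [0, (sin (x $ 1))\<^sup>2]]"

definition antiderivative_on :: "real set \<Rightarrow> (real \<Rightarrow> real) \<Rightarrow> (real \<Rightarrow> real) \<Rightarrow> bool" where
  "antiderivative_on I F f \<longleftrightarrow> (\<forall>r\<in>I. (F has_real_derivative f r) (at r))"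

end

theory Submission
  imports Defs
begin

text \<open>
  Along a map that depends on \<open>r\<close> only and has constant angle, everything happens inside one
  meridian, which is a flat, totally geodesic line of the target: the Christoffel symbols
  \<open>\<Gamma>\<^sup>a\<^sub>1\<^sub>1\<close> of the polar metric vanish. Hence, for a field \<open>v(r) \<partial>\<^sub>\<rho>\<close> along such a map, covariant
  differentiation is ordinary differentiation of \<open>v\<close> (\<open>pullback_conn_meridian\<close>), and the curvature
  term of the bitension field vanishes because all its arguments are multiples of \<open>\<partial>\<^sub>\<rho>\<close>
  (\<open>curvature_at_meridian\<close>). The only trace of the curved geometry is the symbol
  \<open>\<Gamma>\<^sup>1\<^sub>2\<^sub>2 = - sin r cos r\<close> of the domain, so that the tension field and the rough Laplacian both become
  the radial Laplacian \<open>L v = v'' + cot r v' = (sin r v')' / sin r\<close>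
  (\<open>tension_field_meridian\<close>, \<open>rough_laplacian_meridian\<close>), and the map is biharmonic iff
  \<open>L (L \<rho>) = 0\<close>.

  The iterated integral solves this linear equation from the outside in. The two inner quotients
  give \<open>sin r \<rho>' = F2 + C3\<close>, so \<open>L \<rho> = F2' / sin r = C1 F1 + C2\<close>; and \<open>sin r (C1 F1 + C2)' = C1\<close> is
  constant, so \<open>L (L \<rho>) = 0\<close>. If \<open>L \<rho>\<close> vanished identically, its derivative \<open>C1 / sin r\<close> would vanish
  as well, which forces \<open>C1 = 0\<close> and then \<open>C2 = 0\<close>.

  The hypotheses give \<open>\<rho>\<close> one derivative only. That \<open>\<rho>\<close> is smooth follows since all functions
  involved generate an algebra that is closed under differentiation.
\<close>

section \<open>Functions of the first coordinate\<close>

definition radial :: "(real \<Rightarrow> real) \<Rightarrow> real \<Rightarrow> real ^ 2 \<Rightarrow> real ^ 2" where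
  "radial f c x = vector [f (x $ 1), c]"

lemma vector_2_axis: "(vector [a, b] :: real ^ 2) = a *\<^sub>R axis 1 1 + b *\<^sub>R axis 2 1"
  by (simp add: vec_eq_iff forall_2 axis_def)

lemma coord_field_1: "(axis 1 1 :: real ^ 2) $ 1 = 1" "(axis 2 1 :: real ^ 2) $ 1 = 0"
  by (simp_all add: axis_def)

lemma open_polar_domain: "open I \<Longrightarrow> open (polar_domain I)"
  unfolding polar_domain_def
  by (rule open_vimage_vec_nth[unfolded vimage_def])

lemma has_derivative_radial:
  assumes "open I" and "x \<in> polar_domain I"
    and "\<And>y. y \<in> polar_domain I \<Longrightarrow> V y = radial f c y"
    and "(f has_real_derivative f') (at (x $ 1))"
  shows "(V has_derivative (\<lambda>v. vector [f' * v $ 1, 0])) (at x)"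
proof -
  have "((\<lambda>y. f (y $ 1)) has_derivative (\<lambda>v. f' * v $ 1)) (at x)"
    using has_derivative_compose[OF bounded_linear.has_derivative[OF bounded_linear_vec_nth has_derivative_ident]
        assms(4)[unfolded has_field_derivative_def]] .
  then have "(radial f c has_derivative (\<lambda>v. vector [f' * v $ 1, 0])) (at x)"
    unfolding radial_def vector_2_axis
    by (auto intro!: derivative_eq_intros)
  then show ?thesis
    using has_derivative_transform_within_open[OF _ open_polar_domain[OF assms(1)] assms(2)] assms(3)
    by metis
qed

lemma frechet_derivative_radial:
  assumes "open I" and "x \<in> polar_domain I"
    and "\<And>y. y \<in> polar_domain I \<Longrightarrow> V y = radial f c y"
    and "(f has_real_derivative f') (at (x $ 1))"
  shows "frechet_derivative V (at x) v = vector [f' * v $ 1, 0]"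
  using frechet_derivative_at[OF has_derivative_radial[OF assms]] by metis

section \<open>Smoothness\<close>

text \<open>A directional derivative of a radial map is again radial: the profile becomes \<open>f' a\<close>, with \<open>a\<close>
  the first component of the direction, and the angle becomes \<open>0\<close>. So the induction runs within a
  set of profiles that is closed under differentiation and scaling.\<close>

lemma continuously_differentiable_on_radial:
  assumes "open I"
    and closed: "\<And>f. f \<in> S \<Longrightarrow> \<exists>f'\<in>S. antiderivative_on I f f'"
    and scale: "\<And>f a. f \<in> S \<Longrightarrow> (\<lambda>r. f r * a) \<in> S"
    and "f \<in> S" and "\<And>y. y \<in> polar_domain I \<Longrightarrow> V y = radial f c y"
  shows "continuously_differentiable_on k (polar_domain I) V"
  using assms(4,5)
proof (induction k arbitrary: f c V)
  case (0 f c V)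
  obtain f' where f': "antiderivative_on I f f'"
    using closed[OF 0(1)] by blast
  have "isCont V x" if "x \<in> polar_domain I" for x
    using has_derivative_radial[OF assms(1) that 0(2)] f' that
    by (auto simp: antiderivative_on_def polar_domain_def intro: has_derivative_continuous)
  then show ?case
    by (simp add: continuous_at_imp_continuous_on)
next
  case (Suc k f c V)
  obtain f' where f': "f' \<in> S" "antiderivative_on I f f'"
    using closed[OF Suc.prems(1)] by blast
  have deriv: "(f has_real_derivative f' (x $ 1)) (at (x $ 1))" if "x \<in> polar_domain I" for x
    using f'(2) that by (simp add: antiderivative_on_def polar_domain_def)
  have "V differentiable (at x)" if "x \<in> polar_domain I" for x
    using has_derivative_radial[OF assms(1) that Suc.prems(2) deriv[OF that]]
    by (auto simp: differentiable_def)
  moreover have "continuously_differentiable_on k (polar_domain I)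
      (\<lambda>x. frechet_derivative V (at x) v)" for v
    by (rule Suc.IH[OF scale[OF f'(1), of "v $ 1"], where c = 0])
       (simp add: frechet_derivative_radial[OF assms(1) _ Suc.prems(2) deriv] radial_def)
  ultimately show ?case by simp
qed

inductive_set generated_algebra :: "(real \<Rightarrow> real) set \<Rightarrow> (real \<Rightarrow> real) set"
  for G where
  generator: "f \<in> G \<Longrightarrow> f \<in> generated_algebra G"
| const: "(\<lambda>_. a) \<in> generated_algebra G"
| add: "f \<in> generated_algebra G \<Longrightarrow> g \<in> generated_algebra G \<Longrightarrow>
    (\<lambda>r. f r + g r) \<in> generated_algebra G"
| mult: "f \<in> generated_algebra G \<Longrightarrow> g \<in> generated_algebra G \<Longrightarrow>
    (\<lambda>r. f r * g r) \<in> generated_algebra G"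

text \<open>By the sum and product rules, closure under differentiation need only be checked on
  generators.\<close>

lemma generated_algebra_derivative:
  assumes gen: "\<And>f. f \<in> G \<Longrightarrow> \<exists>f'\<in>generated_algebra G. antiderivative_on I f f'"
    and "f \<in> generated_algebra G"
  shows "\<exists>f'\<in>generated_algebra G. antiderivative_on I f f'"
  using assms(2)
proof induction
  case (generator f)
  then show ?case by (rule gen)
next
  case (const a)
  have "antiderivative_on I (\<lambda>_. a) (\<lambda>_. 0)"
    by (simp add: antiderivative_on_def)
  then show ?case
    using generated_algebra.const by blast
next
  case (add f g)
  then obtain f' g' where "f' \<in> generated_algebra G" "g' \<in> generated_algebra G"
    and "antiderivative_on I f f'" "antiderivative_on I g g'" by blast
  then have "(\<lambda>r. f' r + g' r) \<in> generated_algebra G"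
    "antiderivative_on I (\<lambda>r. f r + g r) (\<lambda>r. f' r + g' r)"
    by (auto simp: antiderivative_on_def intro: generated_algebra.add DERIV_add)
  then show ?case by blast
next
  case (mult f g)
  then obtain f' g' where d: "f' \<in> generated_algebra G" "g' \<in> generated_algebra G"
    "antiderivative_on I f f'" "antiderivative_on I g g'" by blast
  then have "(\<lambda>r. f' r * g r + g' r * f r) \<in> generated_algebra G"
    using mult.hyps by (intro generated_algebra.add generated_algebra.mult)
  moreover have "antiderivative_on I (\<lambda>r. f r * g r) (\<lambda>r. f' r * g r + g' r * f r)"
    using d(3,4) by (auto simp: antiderivative_on_def intro!: DERIV_mult)
  ultimately show ?case by blast
qed

lemma smooth_on_radial:
  assumes "open I" and "f \<in> generated_algebra G"
    and "\<And>f. f \<in> G \<Longrightarrow> \<exists>f'\<in>generated_algebra G. antiderivative_on I f f'"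
    and "\<And>y. y \<in> polar_domain I \<Longrightarrow> V y = radial f c y"
  shows "smooth_on (polar_domain I) V"
  unfolding smooth_on_def
  using continuously_differentiable_on_radial[OF assms(1) generated_algebra_derivative[OF assms(3)]
      generated_algebra.mult[OF _ generated_algebra.const] assms(2,4)]
  by blast

section \<open>The polar metric\<close>

lemma matrix_inv_polar:
  assumes "sin (x $ 1) \<noteq> 0"
  shows "matrix_inv (sphere_polar_metric x) = vector [vector [1, 0], vector [0, 1 / (sin (x $ 1))\<^sup>2]]"
    (is "_ = ?B")
proof -
  have "sphere_polar_metric x ** ?B = mat 1" and "?B ** sphere_polar_metric x = mat 1"
    using assms
    by (simp_all add: sphere_polar_metric_def vec_eq_iff forall_2 matrix_matrix_mult_def sum_2 mat_def)
  moreover from this have "invertible (sphere_polar_metric x)"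
    by (auto simp: invertible_def)
  ultimately have "?B ** (sphere_polar_metric x ** matrix_inv (sphere_polar_metric x)) = ?B"
    unfolding invertible_def matrix_inv_def by (metis (mono_tags, lifting) someI_ex matrix_mul_rid)
  then show ?thesis
    using \<open>?B ** sphere_polar_metric x = mat 1\<close> by (simp add: matrix_mul_assoc)
qed

lemma metric_deriv_polar:
  "metric_deriv sphere_polar_metric x k i j =
     (if k = 1 \<and> i = 2 \<and> j = 2 then 2 * sin (x $ 1) * cos (x $ 1) else 0)"
proof -
  have "((\<lambda>y :: real ^ 2. (sin (y $ 1))\<^sup>2) has_derivative
      (\<lambda>v. 2 * sin (x $ 1) * cos (x $ 1) * v $ 1)) (at x)"
    by (auto intro!: derivative_eq_intros bounded_linear.has_derivative[OF bounded_linear_vec_nth]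
        simp: mult_ac)
  from frechet_derivative_at[OF this, symmetric] show ?thesis
    using exhaust_2[of i] exhaust_2[of j] exhaust_2[of k]
    by (auto simp: metric_deriv_def sphere_polar_metric_def axis_def)
qed

text \<open>The bracket of metric derivatives is already zero, whatever the inverse matrix is. Hence the
  symbol vanishes on the whole chart, and \<open>\<nabla>\<close> along the meridian can be evaluated as a field before
  it is differentiated once more in the curvature.\<close>

lemma christoffel_polar_11: "christoffel sphere_polar_metric x a 1 1 = 0"
  by (simp add: christoffel_def metric_deriv_polar)

lemma christoffel_polar_1_22:
  assumes "sin (x $ 1) \<noteq> 0"
  shows "christoffel sphere_polar_metric x 1 2 2 = - sin (x $ 1) * cos (x $ 1)"
  using assms by (simp add: christoffel_def metric_deriv_polar sum_2 matrix_inv_polar)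

lemma levi_civita_coord:
  fixes g :: "2 metric"
  shows "levi_civita g (coord_field i) (coord_field j) x = (\<chi> a. christoffel g x a i j)"
  using exhaust_2[of i] exhaust_2[of j]
  by (auto simp: levi_civita_def pullback_conn_def pushforward_def vec_eq_iff axis_def sum_2)

lemma trace_wrt_polar:
  assumes "sin (x $ 1) \<noteq> 0"
  shows "trace_wrt sphere_polar_metric B x =
    B (coord_field 1) (coord_field 1) x
    + (1 / (sin (x $ 1))\<^sup>2) *\<^sub>R B (coord_field 2) (coord_field 2) x"
  using assms by (simp add: trace_wrt_def sum_2 matrix_inv_polar)

lemma levi_civita_meridian:
  "levi_civita sphere_polar_metric (\<lambda>_. vector [v, 0]) (\<lambda>_. vector [w, 0]) = (\<lambda>_. 0)"
  by (rule ext)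
    (simp add: levi_civita_def pullback_conn_def pushforward_def sum_2 christoffel_polar_11 vec_eq_iff)

text \<open>Constant extensions of the three arguments commute and are parallel along the meridian, so
  each term of the curvature is zero.\<close>

lemma curvature_at_meridian:
  "curvature_at sphere_polar_metric y (vector [u, 0]) (vector [v, 0]) (vector [w, 0]) = 0"
proof -
  have zero: "(0 :: real ^ 2) = vector [0, 0]"
    by (simp add: vec_eq_iff forall_2)
  have "lie_bracket (\<lambda>_. vector [u, 0]) (\<lambda>_. vector [v, 0]) = (\<lambda>_. 0 :: real ^ 2)"
    by (rule ext) (simp add: lie_bracket_def)
  then show ?thesis
    by (simp add: curvature_at_def curvature_def levi_civita_meridian)
       (simp add: zero levi_civita_meridian)
qed

section \<open>Maps into a meridian\<close>

text \<open>Being radial is asked for on the open polar domain only: fields such as the tension field,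
  which are differentiated again below, have their closed form just where \<open>sin r \<noteq> 0\<close>.\<close>

locale meridian_map =
  fixes I :: "real set" and \<phi> :: "real ^ 2 \<Rightarrow> real ^ 2" and \<rho> \<rho>' :: "real \<Rightarrow> real" and c :: real
  assumes open_I: "open I"
    and sin_nonzero: "r \<in> I \<Longrightarrow> sin r \<noteq> 0"
    and map_eq: "x \<in> polar_domain I \<Longrightarrow> \<phi> x = radial \<rho> c x"
    and deriv_map: "antiderivative_on I \<rho> \<rho>'"
begin

lemma sin_nonzero_polar: "x \<in> polar_domain I \<Longrightarrow> sin (x $ 1) \<noteq> 0"
  by (simp add: sin_nonzero polar_domain_def)

lemma pushforward_meridian:
  assumes "x \<in> polar_domain I"
  shows "pushforward \<phi> X x = vector [\<rho>' (x $ 1) * X x $ 1, 0]"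
  unfolding pushforward_def
  using frechet_derivative_radial[OF open_I assms map_eq] deriv_map assms
  by (simp add: antiderivative_on_def polar_domain_def)

text \<open>Both the velocity of the map and the field have no angular component, so only the vanishing
  symbols \<open>\<Gamma>\<^sup>a\<^sub>1\<^sub>1\<close> enter.\<close>

lemma pullback_conn_meridian:
  assumes "x \<in> polar_domain I"
    and "\<And>y. y \<in> polar_domain I \<Longrightarrow> V y = radial v 0 y"
    and "antiderivative_on I v v'"
  shows "pullback_conn sphere_polar_metric \<phi> X V x = vector [v' (x $ 1) * X x $ 1, 0]"
proof -
  have "frechet_derivative V (at x) (X x) = vector [v' (x $ 1) * X x $ 1, 0]"
    using frechet_derivative_radial[OF open_I assms(1,2)] assms(1,3)
    by (simp add: antiderivative_on_def polar_domain_def)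
  then show ?thesis
    by (simp add: pullback_conn_def pushforward_meridian[OF assms(1)] assms(2)[OF assms(1)]
        radial_def sum_2 christoffel_polar_11 vec_eq_iff)
qed

text \<open>The direction \<open>\<partial>\<^sub>\<theta>\<close> is collapsed by the map and contributes only through
  \<open>\<nabla>\<^bsub>\<partial>\<theta>\<^esub> \<partial>\<^sub>\<theta>\<close>, whose radial component \<open>- sin r cos r\<close>, divided by \<open>sin\<^sup>2 r\<close>, gives the first-order term.
  The same happens for the rough Laplacian below.\<close>

lemma tension_field_meridian:
  assumes "x \<in> polar_domain I" and "antiderivative_on I \<rho>' \<rho>''"
  shows "tension_field sphere_polar_metric sphere_polar_metric \<phi> x =
    radial (\<lambda>r. \<rho>'' r + cos r / sin r * \<rho>' r) 0 x"
proof -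
  have d1: "antiderivative_on I (\<lambda>r. \<rho>' r * 1) \<rho>''" and d2: "antiderivative_on I (\<lambda>r. 0) (\<lambda>r. 0)"
    using assms(2) by (simp_all add: antiderivative_on_def)
  have "pullback_conn sphere_polar_metric \<phi> X (pushforward \<phi> (coord_field 1)) x =
      vector [\<rho>'' (x $ 1) * X x $ 1, 0]"
    "pullback_conn sphere_polar_metric \<phi> X (pushforward \<phi> (coord_field 2)) x = vector [0, 0]" for X
    using pullback_conn_meridian[OF assms(1) _ d1, of "pushforward \<phi> (coord_field 1)"]
      pullback_conn_meridian[OF assms(1) _ d2, of "pushforward \<phi> (coord_field 2)"]
    by (simp_all add: pushforward_meridian radial_def coord_field_1)
  then show ?thesis
    using sin_nonzero_polar[OF assms(1)]
    by (simp add: tension_field_def trace_wrt_polar second_fundamental_form_def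
        pushforward_meridian[OF assms(1)] levi_civita_coord christoffel_polar_11 christoffel_polar_1_22
        radial_def vec_eq_iff forall_2 coord_field_1 power2_eq_square)
qed

lemma rough_laplacian_meridian:
  assumes "x \<in> polar_domain I"
    and "\<And>y. y \<in> polar_domain I \<Longrightarrow> V y = radial v 0 y"
    and "antiderivative_on I v v'" and "antiderivative_on I v' v''"
  shows "rough_laplacian sphere_polar_metric sphere_polar_metric \<phi> V x =
    radial (\<lambda>r. v'' r + cos r / sin r * v' r) 0 x"
proof -
  note conn = pullback_conn_meridian[OF _ assms(2,3)]
  have d1: "antiderivative_on I (\<lambda>r. v' r * 1) v''" and d2: "antiderivative_on I (\<lambda>r. 0) (\<lambda>r. 0)"
    using assms(4) by (simp_all add: antiderivative_on_def)
  let ?conn = "pullback_conn sphere_polar_metric \<phi>"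
  have "?conn X (?conn (coord_field 1) V) x = vector [v'' (x $ 1) * X x $ 1, 0]"
    "?conn X (?conn (coord_field 2) V) x = vector [0, 0]" for X
    using pullback_conn_meridian[OF assms(1) _ d1, of "?conn (coord_field 1) V"]
      pullback_conn_meridian[OF assms(1) _ d2, of "?conn (coord_field 2) V"]
    by (simp_all add: conn radial_def coord_field_1)
  then show ?thesis
    using sin_nonzero_polar[OF assms(1)]
    by (simp add: rough_laplacian_def trace_wrt_polar conn[OF assms(1)] levi_civita_coord
        christoffel_polar_11 christoffel_polar_1_22
        radial_def vec_eq_iff forall_2 coord_field_1 power2_eq_square)
qed

lemma bitension_field_meridian:
  assumes "x \<in> polar_domain I"
    and "\<And>y. y \<in> polar_domain I \<Longrightarrow>
      tension_field sphere_polar_metric sphere_polar_metric \<phi> y = radial t 0 y"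
    and "antiderivative_on I t t'" and "antiderivative_on I t' t''"
  shows "bitension_field sphere_polar_metric sphere_polar_metric \<phi> x =
    radial (\<lambda>r. t'' r + cos r / sin r * t' r) 0 x"
  using rough_laplacian_meridian[OF assms]
  by (simp add: bitension_field_def trace_wrt_def pushforward_meridian[OF assms(1)]
      assms(2)[OF assms(1)] radial_def[of t] curvature_at_meridian)

end

section \<open>The biharmonic equation\<close>

theorem corollary4p2:
  fixes C1 C2 C3 C4 a2 \<alpha> \<beta> :: real
    and F1 F2 F3 \<rho> :: "real \<Rightarrow> real"
  assumes "C1\<^sup>2 + C2\<^sup>2 \<noteq> 0"
    and "0 \<le> \<alpha>" and "\<alpha> < \<beta>" and "\<beta> \<le> pi"
    and "antiderivative_on {\<alpha><..<\<beta>} F1 (\<lambda>r. 1 / sin r)"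
    and "antiderivative_on {\<alpha><..<\<beta>} F2 (\<lambda>r. C1 * sin r * F1 r + C2 * sin r)"
    and "antiderivative_on {\<alpha><..<\<beta>} F3 (\<lambda>r. (F2 r + C3) / sin r)"
    and "\<forall>r\<in>{\<alpha><..<\<beta>}. \<rho> r = F3 r + C4"
    and "\<forall>r\<in>{\<alpha><..<\<beta>}. \<rho> r \<in> {0<..<pi}"
  shows "proper_biharmonic_map
           (polar_domain {\<alpha><..<\<beta>}) sphere_polar_metric
           (polar_domain {0<..<pi}) sphere_polar_metric
           (\<lambda>x. vector [\<rho> (x $ 1), a2])"
proof -
  let ?I = "{\<alpha><..<\<beta>}"
  let ?U = "polar_domain ?I"
  let ?g = sphere_polar_metric
  let ?\<phi> = "\<lambda>x :: real ^ 2. vector [\<rho> (x $ 1), a2] :: real ^ 2"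
  define \<rho>' where "\<rho>' r = (F2 r + C3) / sin r" for r
  \<comment> \<open>The second derivative is written as \<open>L \<rho> - cot r \<rho>'\<close> with \<open>L \<rho> = C1 F1 + C2\<close>.\<close>
  define \<rho>'' where "\<rho>'' r = C1 * F1 r + C2 - cos r / sin r * \<rho>' r" for r
  define t where "t r = C1 * F1 r + C2" for r
  define t' where "t' r = C1 / sin r" for r
  have sin_pos: "sin r > 0" if "r \<in> ?I" for r
    using that assms(2,4) by (intro sin_gt_zero) auto
  have dF1: "(F1 has_real_derivative 1 / sin r) (at r)"
    and dF2: "(F2 has_real_derivative C1 * sin r * F1 r + C2 * sin r) (at r)"
    and dF3: "(F3 has_real_derivative \<rho>' r) (at r)" if "r \<in> ?I" for r
    using assms(5,6,7) that by (auto simp: antiderivative_on_def \<rho>'_def)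
  have d\<rho>': "antiderivative_on ?I \<rho>' \<rho>''"
    unfolding antiderivative_on_def
  proof
    fix r assume r: "r \<in> ?I"
    show "(\<rho>' has_real_derivative \<rho>'' r) (at r)"
      unfolding \<rho>'_def \<rho>''_def using sin_pos[OF r]
      by (auto intro!: derivative_eq_intros dF2[OF r] simp: field_simps power2_eq_square)
  qed
  have dt: "antiderivative_on ?I t t'"
    unfolding antiderivative_on_def t_def t'_def
    by (auto intro!: derivative_eq_intros dF1)
  have dt': "antiderivative_on ?I t' (\<lambda>r. - cos r / sin r * t' r)"
    unfolding antiderivative_on_def
  proof
    fix r assume r: "r \<in> ?I"
    show "(t' has_real_derivative - cos r / sin r * t' r) (at r)"
      unfolding t'_def using sin_pos[OF r]
      by (auto intro!: derivative_eq_intros simp: field_simps power2_eq_square)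
  qed
  have d\<rho>: "antiderivative_on ?I \<rho> \<rho>'"
    unfolding antiderivative_on_def
  proof
    fix r assume r: "r \<in> ?I"
    have "((\<lambda>r. F3 r + C4) has_real_derivative \<rho>' r) (at r)"
      by (auto intro!: derivative_eq_intros dF3[OF r])
    then show "(\<rho> has_real_derivative \<rho>' r) (at r)"
      using has_field_derivative_transform_within_open[of _ _ r ?I \<rho>] r assms(8) by auto
  qed
  interpret meridian_map ?I ?\<phi> \<rho> \<rho>' a2
    using d\<rho> sin_pos by unfold_locales (auto simp: radial_def less_imp_neq[symmetric])

  have smooth: "smooth_map ?U (polar_domain {0<..<pi}) ?\<phi>"
  proof -
    let ?csc = "\<lambda>r :: real. 1 / sin r"
    let ?G = "{\<rho>, F1, F2, sin, cos, ?csc}"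
    let ?A = "generated_algebra ?G"
    have gen: "f \<in> ?A" if "f \<in> ?G" for f
      using that by (rule generated_algebra.generator)
    have "\<exists>f'\<in>?A. antiderivative_on ?I f f'" if "f \<in> ?G" for f
    proof -
      note closure = generated_algebra.add generated_algebra.mult generated_algebra.const gen
      have "antiderivative_on ?I \<rho> (\<lambda>r. (F2 r + C3) * ?csc r)"
        using d\<rho> by (simp add: antiderivative_on_def \<rho>'_def)
      moreover have "(\<lambda>r. (F2 r + C3) * ?csc r) \<in> ?A"
        by (intro closure) simp_all
      moreover have "(\<lambda>r. C1 * sin r * F1 r + C2 * sin r) \<in> ?A"
        by (intro closure) simp_all
      moreover have "antiderivative_on ?I sin cos"
        by (simp add: antiderivative_on_def)
      moreover have "antiderivative_on ?I cos (\<lambda>r. (-1) * sin r)"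
        by (auto simp: antiderivative_on_def intro!: derivative_eq_intros)
      moreover have "(\<lambda>r. (-1) * sin r) \<in> ?A"
        by (intro closure) simp_all
      moreover have "antiderivative_on ?I ?csc (\<lambda>r. (-1) * cos r * (?csc r * ?csc r))"
        unfolding antiderivative_on_def
      proof
        fix r assume r: "r \<in> ?I"
        show "(?csc has_real_derivative (-1) * cos r * (?csc r * ?csc r)) (at r)"
          using sin_pos[OF r]
          by (auto intro!: derivative_eq_intros simp: field_simps power2_eq_square)
      qed
      moreover have "(\<lambda>r. (-1) * cos r * (?csc r * ?csc r)) \<in> ?A"
        by (intro closure) simp_all
      moreover have "cos \<in> ?A" "?csc \<in> ?A"
        by (intro gen; simp)+
      ultimately show ?thesis
        using that assms(5,6) by blast
    qed
    then have "smooth_on ?U ?\<phi>"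
      by (intro smooth_on_radial[where f = \<rho> and G = ?G and c = a2] gen) (auto simp: radial_def)
    then show ?thesis
      using assms(9) by (auto simp: smooth_map_def polar_domain_def)
  qed

  have tension: "tension_field ?g ?g ?\<phi> x = radial t 0 x" if "x \<in> ?U" for x
    using tension_field_meridian[OF that d\<rho>'] by (simp add: radial_def \<rho>''_def t_def)
  have "bitension_field ?g ?g ?\<phi> x = 0" if "x \<in> ?U" for x
    using bitension_field_meridian[OF that tension dt dt']
    by (simp add: radial_def vec_eq_iff forall_2)
  with smooth have "biharmonic_map ?U ?g (polar_domain {0<..<pi}) ?g ?\<phi>"
    by (simp add: biharmonic_map_def)
  moreover have "\<not> harmonic_map ?U ?g (polar_domain {0<..<pi}) ?g ?\<phi>"
  proof
    assume harmonic: "harmonic_map ?U ?g (polar_domain {0<..<pi}) ?g ?\<phi>"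
    have t0: "t r = 0" if "r \<in> ?I" for r
    proof -
      have U: "vector [r, 0] \<in> ?U"
        using that by (simp add: polar_domain_def)
      then have "radial t 0 (vector [r, 0]) = 0"
        using harmonic tension by (simp add: harmonic_map_def)
      then show ?thesis
        by (simp add: radial_def vec_eq_iff forall_2)
    qed
    define m where "m = (\<alpha> + \<beta>) / 2"
    have m: "m \<in> ?I"
      using assms(3) by (simp add: m_def)
    have "(t has_real_derivative 0) (at m)"
      by (rule has_field_derivative_transform_within_open[of "\<lambda>_. 0" _ _ ?I]) (use m t0 in auto)
    then have "t' m = 0"
      using dt m DERIV_unique unfolding antiderivative_on_def by blast
    then have "C1 = 0"
      using sin_pos[OF m] by (simp add: t'_def)
    with t0[OF m] show False
      using assms(1) by (simp add: t_def)
  qed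
  ultimately show ?thesis
    by (simp add: proper_biharmonic_map_def)
qed

end
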